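(* For every $d\ge1$ there are constants $C_d,N_d>0$ such that for every log-concave isotropic density $f:\mathbb{R}^d\to\mathbb{R}_+$ with covariance matrix $\sigma^2I_d$ and $\sigma\ge N_d$, $$\left|\int_{\mathbb{R}^d}f\,dx-\sum_{k\in\mathbb{Z}^d}f(k)\right|\le\frac{C_d}{\sigma}.$$
   Context: A density $f$ on $\mathbb{R}^d$ (non-negative with $\int f=1$) is log-concave if $f=e^{-V}$ with $V:\mathbb{R}^d\to\mathbb{R}\cup\{+\infty\}$ convex. It is isotropic if its covariance matrix is $\sigma^2I_d$ for some $\sigma>0$. *)

theory Defs
  imports "HOL-Analysis.Analysis"
begin

definition is_density :: "(real ^ 'n \<Rightarrow> real) \<Rightarrow> bool" where
  "is_density f \<longleftrightarrow> (\<forall>x. 0 \<le> f x) \<and> integrable lebesgue f \<and> (LINT x|lebesgue. f x) = 1"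

text \<open>Convexity for functions with values in the reals extended by plus infinity.\<close>

definition ext_convex :: "('a::real_vector \<Rightarrow> ereal) \<Rightarrow> bool" where
  "ext_convex V \<longleftrightarrow> (\<forall>x. V x \<noteq> -\<infinity>) \<and>
     (\<forall>x y. \<forall>t\<in>{0<..<1::real}.
        V ((1 - t) *\<^sub>R x + t *\<^sub>R y) \<le> ereal (1 - t) * V x + ereal t * V y)"

definition exp_minus :: "ereal \<Rightarrow> real" where
  "exp_minus v = (if v = \<infinity> then 0 else exp (- real_of_ereal v))"

definition log_concave :: "('a::real_vector \<Rightarrow> real) \<Rightarrow> bool" where
  "log_concave f \<longleftrightarrow> (\<exists>V. ext_convex V \<and> (\<forall>x. f x = exp_minus (V x)))"

definition density_mean :: "(real ^ 'n \<Rightarrow> real) \<Rightarrow> real ^ 'n" where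
  "density_mean f = (\<chi> i. LINT x|lebesgue. x $ i * f x)"

text \<open>The integrals below are 0 by convention when they diverge. A log-concave density
  has finite moments of all orders, so for these densities the convention is never used.\<close>

definition covariance_matrix :: "(real ^ 'n \<Rightarrow> real) \<Rightarrow> real ^ 'n ^ 'n" where
  "covariance_matrix f =
     (\<chi> i j. LINT x|lebesgue. (x $ i - density_mean f $ i) * (x $ j - density_mean f $ j) * f x)"

definition isotropic_with :: "real \<Rightarrow> (real ^ 'n \<Rightarrow> real) \<Rightarrow> bool" where
  "isotropic_with \<sigma> f \<longleftrightarrow> 0 < \<sigma> \<and> covariance_matrix f = \<sigma>\<^sup>2 *\<^sub>R mat 1"

definition integer_lattice :: "(real ^ 'n) set" where
  "integer_lattice = {x. \<forall>i. x $ i \<in> \<int>}"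

end

theory Submission
  imports Defs
begin

text \<open>Let \<open>a\<close> be a fixed fraction (depending on \<open>d\<close>) of \<open>sup f\<close>. The superlevel set of \<open>f\<close> at
  height \<open>a\<close> contains a ball around some \<open>x\<^sub>0\<close> of radius \<open>r = c\<^sub>d \<sigma>\<close>: if it were contained in a thin slab,
  then by log-concavity the variance across the slab would be smaller than \<open>\<sigma>\<^sup>2\<close>; being wide in every
  direction, it contains a simplex, spanned by points with nearly maximal determinant, whose inradius is
  of order \<open>\<sigma>\<close>. Now put \<open>\<eta> = \<surd>d / r\<close> and let \<open>S\<close> be the contraction by the factor \<open>1 - \<eta>\<close> towards \<open>x\<^sub>0\<close>.
  Log-concavity on segments ending in the ball gives \<open>f y \<le> (sup f / a)\<^sup>\<eta> f w\<close> whenever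
  \<open>w\<close> is within \<open>\<surd>d\<close> of \<open>S y\<close>. Using this for \<open>(y, w) = (\<lfloor>x\<rfloor>, S x)\<close> and for
  \<open>(y, w) = (x, \<lfloor>S x\<rfloor>)\<close> and integrating, one finds that the lattice sum and the integral agree
  up to the factor \<open>(sup f / a)\<^sup>\<eta> (1 - \<eta>)\<^sup>-\<^sup>d = 1 + O(1/\<sigma>)\<close>.\<close>

section \<open>Log-concavity in multiplicative form\<close>

lemma log_concave_nonneg: "log_concave f \<Longrightarrow> 0 \<le> f x"
  by (auto simp: log_concave_def exp_minus_def)

lemma log_concaveD:
  assumes "log_concave f" "0 \<le> t" "t \<le> 1"
  shows "f x powr (1 - t) * f y powr t \<le> f ((1 - t) *\<^sub>R x + t *\<^sub>R y)"
proof -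
  obtain V where V: "ext_convex V" and f: "\<And>x. f x = exp_minus (V x)"
    using assms(1) by (auto simp: log_concave_def)
  have nonneg: "0 \<le> f z" for z
    by (rule log_concave_nonneg[OF assms(1)])
  \<comment> \<open>Since \<open>0 powr t = 0\<close> even for \<open>t = 0\<close>, the left-hand
    side vanishes as soon as \<open>f\<close> vanishes at \<open>x\<close> or \<open>y\<close>.
    Convexity of \<open>V\<close> speaks only about \<open>0 < t < 1\<close>, so the end values of
    \<open>t\<close> are separate cases.\<close>
  consider "f x = 0 \<or> f y = 0" | "t = 0" "f x \<noteq> 0" | "t = 1" "f y \<noteq> 0"
    | "f x \<noteq> 0" "f y \<noteq> 0" "0 < t" "t < 1"
    using assms by linarith
  then show ?thesis
  proof cases
    case 4
    have fin: "V x \<noteq> \<infinity>" "V y \<noteq> \<infinity>"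
      using 4 by (auto simp: f exp_minus_def)
    moreover have MInf: "V z \<noteq> -\<infinity>" for z
      using V by (simp add: ext_convex_def)
    ultimately obtain p q where p: "V x = ereal p" and q: "V y = ereal q"
      by (metis ereal_cases)
    have "V ((1 - t) *\<^sub>R x + t *\<^sub>R y) \<le> ereal (1 - t) * V x + ereal t * V y"
      using V 4 unfolding ext_convex_def by auto
    also have "\<dots> = ereal ((1 - t) * p + t * q)"
      by (simp add: p q)
    finally obtain s where s: "V ((1 - t) *\<^sub>R x + t *\<^sub>R y) = ereal s" "s \<le> (1 - t) * p + t * q"
      using MInf[of "(1 - t) *\<^sub>R x + t *\<^sub>R y"]
      by (cases "V ((1 - t) *\<^sub>R x + t *\<^sub>R y)") auto
    have "exp (- p) powr (1 - t) * exp (- q) powr t = exp (- ((1 - t) * p + t * q))"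
      by (simp add: powr_def exp_add[symmetric] algebra_simps)
    also have "\<dots> \<le> exp (- s)"
      using s(2) by simp
    finally show ?thesis
      by (simp add: f p q s exp_minus_def)
  qed (use nonneg[of x] nonneg[of y] in \<open>auto simp: nonneg\<close>)
qed

lemma convex_superlevel:
  assumes "log_concave f" "0 < a"
  shows "convex {x. a \<le> f x}"
  unfolding convex_alt
proof (intro ballI allI impI)
  fix x y and t :: real
  assume *: "x \<in> {x. a \<le> f x}" "y \<in> {x. a \<le> f x}" "0 \<le> t \<and> t \<le> 1"
  have "a = a powr (1 - t) * a powr t"
    using assms(2) by (simp add: powr_add[symmetric])
  also have "\<dots> \<le> f x powr (1 - t) * f y powr t"
    using * assms(2) by (intro mult_mono powr_mono2) auto
  also have "\<dots> \<le> f ((1 - t) *\<^sub>R x + t *\<^sub>R y)"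
    using * by (intro log_concaveD assms) auto
  finally show "(1 - t) *\<^sub>R x + t *\<^sub>R y \<in> {x. a \<le> f x}"
    by simp
qed

lemma log_concave_midpoint:
  assumes "log_concave f"
  shows "f x * f y \<le> (f (midpoint x y))\<^sup>2"
proof -
  have n: "0 \<le> f z" for z
    by (rule log_concave_nonneg[OF assms])
  have "f x powr (1 - 1/2) * f y powr (1/2) \<le> f ((1 - 1/2) *\<^sub>R x + (1/2) *\<^sub>R y)"
    by (rule log_concaveD[OF assms]) auto
  moreover have "(1 - 1/2) *\<^sub>R x + (1/2) *\<^sub>R y = midpoint x y"
    by (simp add: midpoint_def scaleR_add_right)
  ultimately have "sqrt (f x * f y) \<le> f (midpoint x y)"
    using n by (simp add: powr_half_sqrt real_sqrt_mult)
  then show ?thesis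
    using n by (simp add: real_le_rsqrt sqrt_le_D)
qed

section \<open>Scaling of Lebesgue integrals\<close>

lemma nn_integral_affine_lebesgue:
  fixes t :: "'a::euclidean_space"
  assumes f: "f \<in> borel_measurable lebesgue" and c: "0 < c"
  shows "(\<integral>\<^sup>+x. f x \<partial>lebesgue) = ennreal (c ^ DIM('a)) * (\<integral>\<^sup>+x. f (t + c *\<^sub>R x) \<partial>lebesgue)"
proof -
  \<comment> \<open>Library form of an affine map, with one factor per coordinate; equal factors
    \<open>c\<close> give Jacobian \<open>c ^ DIM('a)\<close>.\<close>
  let ?T = "\<lambda>x::'a. t + (\<Sum>j\<in>Basis. (c * (x \<bullet> j)) *\<^sub>R j)"
  have T: "?T = (\<lambda>x. t + c *\<^sub>R x)"
    by (simp add: fun_eq_iff scaleR_scaleR[symmetric] scaleR_sum_right[symmetric] euclidean_representation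
        del: scaleR_scaleR)
  have m: "(\<lambda>x. t + c *\<^sub>R x) \<in> lebesgue \<rightarrow>\<^sub>M lebesgue"
    using lebesgue_affine_measurable[of "\<lambda>_. c" t] c T by simp
  have "lebesgue = density (distr lebesgue lebesgue (\<lambda>x. t + c *\<^sub>R x)) (\<lambda>_. ennreal (c ^ DIM('a)))"
    using lebesgue_affine_euclidean[of "\<lambda>_. c" t] c T by simp
  then have "(\<integral>\<^sup>+x. f x \<partial>lebesgue) =
      (\<integral>\<^sup>+x. f x \<partial>density (distr lebesgue lebesgue (\<lambda>x. t + c *\<^sub>R x)) (\<lambda>_. ennreal (c ^ DIM('a))))"
    by simp
  also have "\<dots> = ennreal (c ^ DIM('a)) * (\<integral>\<^sup>+x. f (t + c *\<^sub>R x) \<partial>lebesgue)"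
    using f m by (simp add: nn_integral_density nn_integral_cmult nn_integral_distr)
  finally show ?thesis .
qed

lemma measurable_affine_lebesgue:
  fixes t :: "'a::euclidean_space"
  assumes f: "f \<in> borel_measurable lebesgue" and c: "0 < c"
  shows "(\<lambda>x. f (t + c *\<^sub>R x)) \<in> borel_measurable lebesgue"
proof -
  have "(\<lambda>x::'a. t + (\<Sum>j\<in>Basis. (c * (x \<bullet> j)) *\<^sub>R j)) = (\<lambda>x. t + c *\<^sub>R x)"
    by (simp add: fun_eq_iff scaleR_scaleR[symmetric] scaleR_sum_right[symmetric] euclidean_representation
        del: scaleR_scaleR)
  then have "(\<lambda>x. t + c *\<^sub>R x) \<in> lebesgue \<rightarrow>\<^sub>M lebesgue"
    using lebesgue_affine_measurable[of "\<lambda>_. c" t] c by simp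
  then show ?thesis
    using f by (rule measurable_compose)
qed

section \<open>Rounding to the integer lattice\<close>

definition vec_floor :: "real ^ 'n \<Rightarrow> real ^ 'n" where
  "vec_floor x = (\<chi> i. of_int \<lfloor>x $ i\<rfloor>)"

lemma vec_floor_in_lattice: "vec_floor x \<in> integer_lattice"
  by (simp add: vec_floor_def integer_lattice_def)

lemma norm_diff_vec_floor_le: "norm (x - vec_floor (x :: real ^ 'n)) \<le> sqrt (real CARD('n))"
proof -
  have "(norm (x - vec_floor x))\<^sup>2 = (\<Sum>i\<in>UNIV. (x $ i - of_int \<lfloor>x $ i\<rfloor>)\<^sup>2)"
    unfolding power2_norm_eq_inner by (simp add: inner_vec_def vec_floor_def power2_eq_square)
  also have "\<dots> \<le> (\<Sum>i\<in>(UNIV :: 'n set). 1)"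
  proof (rule sum_mono)
    fix i
    have "0 \<le> x $ i - of_int \<lfloor>x $ i\<rfloor>" "x $ i - of_int \<lfloor>x $ i\<rfloor> \<le> 1"
      by linarith+
    then show "(x $ i - of_int \<lfloor>x $ i\<rfloor>)\<^sup>2 \<le> 1"
      by (simp add: power_le_one)
  qed
  finally show ?thesis
    by (simp add: real_le_rsqrt)
qed

lemma countable_integer_lattice: "countable (integer_lattice :: (real ^ 'n) set)"
proof -
  have "countable {v :: 'n \<Rightarrow> real. \<forall>i. v i \<in> \<int>}"
  proof -
    have "countable (\<int> :: real set)"
      by (simp add: Ints_def)
    then have "countable (PiE (UNIV :: 'n set) (\<lambda>_. \<int> :: real set))"
      by (intro countable_PiE) auto
    then show ?thesis
      by (simp add: PiE_UNIV_domain Pi_def)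
  qed
  then have "countable (vec_lambda ` {v :: 'n \<Rightarrow> real. \<forall>i. v i \<in> \<int>})"
    by (rule countable_image)
  moreover have "integer_lattice \<subseteq> vec_lambda ` {v :: 'n \<Rightarrow> real. \<forall>i. v i \<in> \<int>}"
  proof
    fix x :: "real ^ 'n"
    assume "x \<in> integer_lattice"
    then have "(\<lambda>i. x $ i) \<in> {v. \<forall>i. v i \<in> \<int>}"
      by (simp add: integer_lattice_def)
    then show "x \<in> vec_lambda ` {v. \<forall>i. v i \<in> \<int>}"
      by (metis imageI vec_nth_inverse)
  qed
  ultimately show ?thesis
    using countable_subset by blast
qed

lemma vec_floor_vimage:
  assumes "k \<in> integer_lattice"
  shows "vec_floor -` {k} = {x. \<forall>i. k $ i \<le> x $ i \<and> x $ i < k $ i + 1}"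
proof -
  have "of_int \<lfloor>x $ i\<rfloor> = k $ i \<longleftrightarrow> k $ i \<le> x $ i \<and> x $ i < k $ i + 1" for x i
  proof -
    obtain n where n: "k $ i = of_int n"
      using assms by (auto simp: integer_lattice_def elim: Ints_cases)
    show ?thesis
      unfolding n using floor_eq_iff[of "x $ i" n] by auto
  qed
  then show ?thesis
    by (auto simp: vec_floor_def vec_eq_iff)
qed

lemma emeasure_vec_floor_vimage:
  fixes k :: "real ^ 'n"
  assumes "k \<in> integer_lattice"
  shows "vec_floor -` {k} \<in> sets borel" "emeasure lebesgue (vec_floor -` {k}) = 1"
proof -
  \<comment> \<open>The fibre is a half-open unit cube, caught between an open and a closed box of
    volume 1.\<close>
  have box: "box k (k + 1) \<subseteq> vec_floor -` {k}" "vec_floor -` {k} \<subseteq> cbox k (k + 1)"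
    by (auto simp: vec_floor_vimage[OF assms] mem_box_cart less_imp_le)
  show meas: "vec_floor -` {k} \<in> sets borel"
    unfolding vec_floor_vimage[OF assms] by measurable
  have prod: "(\<Prod>b\<in>Basis. ((k + 1) - k) \<bullet> b) = 1"
    by (rule prod.neutral) (auto simp: Basis_vec_def inner_axis)
  have le: "\<forall>b\<in>Basis. k \<bullet> b \<le> (k + 1) \<bullet> b"
    by (auto simp: Basis_vec_def inner_axis)
  have "emeasure lborel (box k (k + 1)) = 1" "emeasure lborel (cbox k (k + 1)) = 1"
    using prod le by (auto simp: emeasure_lborel_box_eq emeasure_lborel_cbox_eq)
  moreover have "emeasure lborel (box k (k + 1)) \<le> emeasure lborel (vec_floor -` {k})"
    "emeasure lborel (vec_floor -` {k}) \<le> emeasure lborel (cbox k (k + 1))"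
    using box meas by (auto intro!: emeasure_mono)
  ultimately show "emeasure lebesgue (vec_floor -` {k}) = 1"
    using meas by simp
qed

lemma measurable_vec_floor: "vec_floor \<in> lebesgue \<rightarrow>\<^sub>M count_space (integer_lattice :: (real ^ 'n) set)"
proof -
  have "vec_floor -` {k} \<in> sets lebesgue" if "k \<in> integer_lattice" for k :: "real ^ 'n"
    using emeasure_vec_floor_vimage(1)[OF that] by simp
  then show ?thesis
    by (subst measurable_count_space_eq_countable[OF countable_integer_lattice])
      (auto simp: vec_floor_in_lattice)
qed

text \<open>Each lattice point has a fibre of volume 1, so rounding pushes Lebesgue measure forward
  to counting measure. This rewrites lattice sums as integrals.\<close>

lemma distr_vec_floor:
  "distr lebesgue (count_space integer_lattice) vec_floor = count_space (integer_lattice :: (real ^ 'n) set)"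
proof (rule measure_eqI_countable[where A = integer_lattice])
  fix k :: "real ^ 'n"
  assume k: "k \<in> integer_lattice"
  then show "emeasure (distr lebesgue (count_space integer_lattice) vec_floor) {k} =
      emeasure (count_space integer_lattice) {k}"
    using emeasure_vec_floor_vimage(2)[OF k] by (simp add: emeasure_distr[OF measurable_vec_floor])
qed (auto simp: countable_integer_lattice)

lemma measurable_comp_vec_floor: "(\<lambda>x. f (vec_floor x)) \<in> borel_measurable lebesgue"
  by (rule measurable_compose[OF measurable_vec_floor]) simp

lemma nn_integral_vec_floor:
  fixes f :: "real ^ 'n \<Rightarrow> ennreal"
  shows "(\<integral>\<^sup>+x. f (vec_floor x) \<partial>lebesgue) = (\<integral>\<^sup>+k. f k \<partial>count_space integer_lattice)"
  by (subst distr_vec_floor[symmetric], subst nn_integral_distr[OF measurable_vec_floor]) auto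

section \<open>Upper bound for \<open>f\<close> and boundedness of superlevel sets\<close>

text \<open>The convex set where \<open>f\<close> is positive has interior points, as it would
  otherwise be null and the integral 0. A uniform lower bound near such a point comes from the
  finitely many vertices of a cube, by convexity of superlevel sets.\<close>

lemma ex_cball_superlevel:
  fixes f :: "'a::euclidean_space \<Rightarrow> real"
  assumes f: "log_concave f" "(LINT x|lebesgue. f x) \<noteq> 0"
  obtains p \<rho> \<epsilon> where "0 < \<rho>" "0 < \<epsilon>" "cball p \<rho> \<subseteq> {x. \<epsilon> \<le> f x}"
proof -
  let ?S = "{x. 0 < f x}"
  have "convex ?S"
    unfolding convex_alt
  proof (intro ballI allI impI)
    fix x y and t :: real
    assume *: "x \<in> ?S" "y \<in> ?S" "0 \<le> t \<and> t \<le> 1"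
    have "0 < f x powr (1 - t) * f y powr t"
      using * by simp
    also have "\<dots> \<le> f ((1 - t) *\<^sub>R x + t *\<^sub>R y)"
      using * by (intro log_concaveD f) auto
    finally show "(1 - t) *\<^sub>R x + t *\<^sub>R y \<in> ?S"
      by simp
  qed
  have "interior ?S \<noteq> {}"
  proof
    assume "interior ?S = {}"
    then have "?S \<in> null_sets lebesgue"
      using negligible_convex_interior[OF \<open>convex ?S\<close>] by (simp add: negligible_iff_null_sets)
    moreover have "{x \<in> space lebesgue. f x \<noteq> 0} \<subseteq> ?S"
      using log_concave_nonneg[OF f(1)] by (auto simp: less_le)
    ultimately have "AE x in lebesgue. f x = 0"
      by (auto intro: AE_I')
    then show False
      using f(2) integral_eq_zero_AE by blast
  qed
  then obtain p e where e: "0 < e" "cball p e \<subseteq> ?S"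
    by (meson all_not_in_conv mem_interior_cball)
  \<comment> \<open>The l1 bound on the norm puts the cube of half-side \<open>d\<close> inside
    \<open>cball p e\<close>.\<close>
  define d where "d = e / real DIM('a)"
  have d: "0 < d"
    using e by (simp add: d_def)
  let ?d = "\<Sum>i\<in>Basis. d *\<^sub>R i :: 'a"
  have di: "?d \<bullet> i = d" if "i \<in> Basis" for i
    using that by (simp add: inner_sum_left inner_Basis if_distrib sum.delta cong: if_cong)
  obtain F where F: "finite F" "cbox (p - ?d) (p + ?d) = convex hull F"
    using cube_convex_hull[OF d] .
  have sub: "cbox (p - ?d) (p + ?d) \<subseteq> cball p e"
  proof
    fix x assume x: "x \<in> cbox (p - ?d) (p + ?d)"
    have "norm (x - p) \<le> (\<Sum>i\<in>Basis. \<bar>(x - p) \<bullet> i\<bar>)"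
      by (rule norm_le_l1)
    also have "\<dots> \<le> (\<Sum>i\<in>(Basis :: 'a set). d)"
      using x by (intro sum_mono) (auto simp: mem_box inner_diff_left inner_add_left di abs_le_iff algebra_simps)
    also have "\<dots> = e"
      by (simp add: d_def)
    finally show "x \<in> cball p e"
      by (simp add: dist_norm norm_minus_commute)
  qed
  have cb: "cball p d \<subseteq> cbox (p - ?d) (p + ?d)"
  proof
    fix x assume x: "x \<in> cball p d"
    have "\<bar>(x - p) \<bullet> i\<bar> \<le> d" if "i \<in> Basis" for i
      using Basis_le_norm[OF that, of "x - p"] x by (simp add: dist_norm norm_minus_commute)
    then show "x \<in> cbox (p - ?d) (p + ?d)"
      by (auto simp: mem_box inner_diff_left inner_add_left di abs_le_iff algebra_simps)
  qed
  have "p \<in> cball p d"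
    using d by simp
  with cb F have "F \<noteq> {}"
    by (metis convex_hull_empty empty_iff subsetD)
  have FS: "F \<subseteq> ?S"
    using hull_subset[of F convex] F(2) sub e(2) by blast
  define \<epsilon> where "\<epsilon> = Min (f ` F)"
  have "\<epsilon> \<in> f ` F"
    unfolding \<epsilon>_def using F(1) \<open>F \<noteq> {}\<close> by (intro Min_in) auto
  then have "0 < \<epsilon>"
    using FS by auto
  moreover have "F \<subseteq> {x. \<epsilon> \<le> f x}"
    using F(1) by (auto simp: \<epsilon>_def)
  then have "convex hull F \<subseteq> {x. \<epsilon> \<le> f x}"
    using convex_superlevel[OF f(1) \<open>0 < \<epsilon>\<close>] by (rule hull_minimal)
  ultimately show thesis
    using that[OF d] cb F(2) by blast
qed

lemma measure_cball_mult_le_integral: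
  fixes g :: "'a::euclidean_space \<Rightarrow> real"
  assumes g: "integrable lebesgue g" "\<And>x. 0 \<le> g x" and c: "\<And>x. x \<in> cball q s \<Longrightarrow> c \<le> g x"
  shows "c * measure lebesgue (cball q s) \<le> (LINT x|lebesgue. g x)"
proof -
  have fin: "cball q s \<in> lmeasurable"
    by (rule lmeasurable_cball)
  then have "integrable lebesgue (\<lambda>x. c * indicator (cball q s) x)"
    by (intro integrable_mult_right) (simp add: fmeasurable_def)
  then have "(LINT x|lebesgue. c * indicator (cball q s) x) \<le> (LINT x|lebesgue. g x)"
    by (rule integral_mono[OF _ g(1)]) (use g(2) c in \<open>auto simp: indicator_def\<close>)
  then show ?thesis
    by simp
qed

lemma measure_cball_translate:
  fixes q :: "'a::euclidean_space"
  shows "measure lebesgue (cball q s) = measure lebesgue (cball (0 :: 'a::euclidean_space) s)"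
  using content_ball_conv_unit_ball[of s q] content_ball_conv_unit_ball[of s "0 :: 'a"]
  by (cases "0 \<le> s") (simp_all add: content_cball_conv_ball)

text \<open>The homothety with centre \<open>y\<close> and ratio 1/2 maps
  \<open>cball p \<rho>\<close> onto this ball, so \<open>x\<close> is the midpoint of
  \<open>y\<close> and a point where \<open>f\<close> is at least \<open>\<epsilon>\<close>.\<close>

lemma cball_midpoint_superlevel:
  fixes f :: "'a::euclidean_space \<Rightarrow> real"
  assumes f: "log_concave f" and p: "cball p \<rho> \<subseteq> {x. \<epsilon> \<le> f x}" "0 \<le> \<epsilon>"
    and x: "x \<in> cball (midpoint y p) (\<rho> / 2)"
  shows "sqrt (f y * \<epsilon>) \<le> f x"
proof -
  let ?z = "2 *\<^sub>R x - y"
  have "?z - p = 2 *\<^sub>R (x - midpoint y p)"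
    by (simp add: midpoint_def algebra_simps)
  then have "dist p ?z = 2 * dist (midpoint y p) x"
    by (metis (no_types) abs_numeral dist_commute dist_norm norm_scaleR)
  then have "?z \<in> cball p \<rho>"
    using x by simp
  then have "\<epsilon> \<le> f ?z"
    using p by blast
  then have "f y * \<epsilon> \<le> f y * f ?z"
    by (intro mult_left_mono log_concave_nonneg[OF f])
  also have "\<dots> \<le> (f (midpoint y ?z))\<^sup>2"
    by (rule log_concave_midpoint[OF f])
  also have "midpoint y ?z = x"
    by (simp add: midpoint_def)
  finally show ?thesis
    using log_concave_nonneg[OF f] by (simp add: real_le_lsqrt)
qed

text \<open>A large value \<open>f y\<close> makes \<open>f\<close> at least
  \<open>sqrt (f y * \<epsilon>)\<close> on a ball whose volume does not depend on \<open>y\<close>;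
  the integral limits this.\<close>

lemma log_concave_bounded_above:
  fixes f :: "'a::euclidean_space \<Rightarrow> real"
  assumes f: "log_concave f" "integrable lebesgue f" "(LINT x|lebesgue. f x) \<noteq> 0"
  shows "bdd_above (range f)"
proof -
  obtain p \<rho> \<epsilon> where p: "0 < \<rho>" "0 < \<epsilon>" "cball p \<rho> \<subseteq> {x. \<epsilon> \<le> f x}"
    using ex_cball_superlevel[OF f(1,3)] .
  define \<kappa> where "\<kappa> = measure lebesgue (cball (0 :: 'a) (\<rho> / 2))"
  have \<kappa>: "0 < \<kappa>"
    using p(1) content_cball_pos[of "\<rho> / 2" "0 :: 'a"] by (simp add: \<kappa>_def)
  have \<kappa>': "measure lborel (cball z (\<rho> / 2)) = \<kappa>" for z :: 'a
    using measure_cball_translate[of z "\<rho> / 2"] by (simp add: \<kappa>_def)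
  let ?I = "LINT x|lebesgue. f x"
  have "f y \<le> (?I / \<kappa>)\<^sup>2 / \<epsilon>" for y
  proof -
    have "sqrt (f y * \<epsilon>) * measure lebesgue (cball (midpoint y p) (\<rho> / 2)) \<le> ?I"
      using cball_midpoint_superlevel[OF f(1) p(3)] p(2)
      by (intro measure_cball_mult_le_integral f log_concave_nonneg[OF f(1)]) auto
    then have "sqrt (f y * \<epsilon>) \<le> ?I / \<kappa>"
      using \<kappa> by (simp add: \<kappa>' field_simps)
    then have "f y * \<epsilon> \<le> (?I / \<kappa>)\<^sup>2"
      by (rule sqrt_le_D)
    then show ?thesis
      using p(2) by (simp only: pos_le_divide_eq)
  qed
  then show ?thesis
    by (intro bdd_aboveI) auto
qed

text \<open>A far point \<open>y\<close> with \<open>a \<le> f y\<close> makes \<open>f\<close> at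
  least \<open>sqrt (a * \<epsilon>)\<close> on a ball of fixed size around a far midpoint; the
  finite second moment limits how far.\<close>

lemma bounded_superlevel:
  fixes f :: "'a::euclidean_space \<Rightarrow> real"
  assumes f: "log_concave f" "(LINT x|lebesgue. f x) \<noteq> 0"
    and int: "integrable lebesgue (\<lambda>x. (norm (x - q))\<^sup>2 * f x)" and a: "0 < a"
  shows "bounded {x. a \<le> f x}"
proof -
  obtain p \<rho> \<epsilon> where p: "0 < \<rho>" "0 < \<epsilon>" "cball p \<rho> \<subseteq> {x. \<epsilon> \<le> f x}"
    using ex_cball_superlevel[OF f] .
  define \<kappa> where "\<kappa> = measure lebesgue (cball (0 :: 'a) (\<rho> / 2))"
  have \<kappa>: "0 < \<kappa>"
    using p(1) content_cball_pos[of "\<rho> / 2" "0 :: 'a"] by (simp add: \<kappa>_def)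
  have \<kappa>': "measure lborel (cball z (\<rho> / 2)) = \<kappa>" for z :: 'a
    using measure_cball_translate[of z "\<rho> / 2"] by (simp add: \<kappa>_def)
  define b where "b = sqrt (a * \<epsilon>)"
  have b: "0 < b"
    using a p(2) by (simp add: b_def)
  let ?J = "LINT x|lebesgue. (norm (x - q))\<^sup>2 * f x"
  have J: "0 \<le> ?J"
    using log_concave_nonneg[OF f(1)] by simp
  have "norm y \<le> 2 * (norm q + \<rho> / 2 + sqrt (?J / (b * \<kappa>))) + norm p" if y: "a \<le> f y" for y
  proof -
    \<comment> \<open>A lower bound for the distance from \<open>q\<close> to points of the ball. It
      is negative if \<open>q\<close> is interior to the ball, and the claim is then
      trivial.\<close>
    define s where "s = norm (midpoint y p - q) - \<rho> / 2"
    have "s \<le> sqrt (?J / (b * \<kappa>))"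
    proof (cases "0 \<le> s")
      case True
      have "s\<^sup>2 * b * measure lebesgue (cball (midpoint y p) (\<rho> / 2)) \<le> ?J"
      proof (rule measure_cball_mult_le_integral[OF int])
        fix x assume x: "x \<in> cball (midpoint y p) (\<rho> / 2)"
        have "norm (midpoint y p - q) \<le> norm (midpoint y p - x) + norm (x - q)"
          using norm_triangle_ineq[of "midpoint y p - x" "x - q"] by simp
        then have "s \<le> norm (x - q)"
          using x by (simp add: s_def dist_norm)
        moreover have "b \<le> f x"
          using cball_midpoint_superlevel[OF f(1) p(3) _ x] p(2) y
          unfolding b_def by (meson less_imp_le mult_right_mono order_trans real_sqrt_le_mono)
        ultimately show "s\<^sup>2 * b \<le> (norm (x - q))\<^sup>2 * f x"
          using True b by (intro mult_mono power_mono) auto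
      qed (simp add: log_concave_nonneg[OF f(1)])
      then have "s\<^sup>2 \<le> ?J / (b * \<kappa>)"
        using \<kappa> b by (simp add: \<kappa>' field_simps)
      then show ?thesis
        by (rule real_le_rsqrt)
    next
      case False
      moreover have "0 \<le> sqrt (?J / (b * \<kappa>))"
        using J b \<kappa> by simp
      ultimately show ?thesis
        by linarith
    qed
    then have "norm (midpoint y p - q) \<le> \<rho> / 2 + sqrt (?J / (b * \<kappa>))"
      by (simp add: s_def)
    moreover have "y = 2 *\<^sub>R (midpoint y p - q) + 2 *\<^sub>R q - p"
      by (simp add: midpoint_def algebra_simps)
    then have "norm y \<le> 2 * norm (midpoint y p - q) + 2 * norm q + norm p"
      by (metis (no_types) abs_numeral add_right_mono norm_scaleR norm_triangle_ineq norm_triangle_ineq4 order_trans)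
    ultimately show ?thesis
      by argo
  qed
  then show ?thesis
    by (intro boundedI) auto
qed

section \<open>Second moment across a slab\<close>

text \<open>Halving the distance to \<open>x\<^sub>1\<close> multiplies \<open>f\<close> by a large factor outside twice the slab, so at
  most half of the second moment comes from there.\<close>

lemma second_moment_le_of_slab:
  fixes f :: "'a::euclidean_space \<Rightarrow> real"
  assumes f: "log_concave f" "integrable lebesgue f" "(LINT x|lebesgue. f x) = 1"
    and int: "integrable lebesgue (\<lambda>x. (u \<bullet> (x - x1))\<^sup>2 * f x)"
    and M: "0 < M" "M / 2 \<le> f x1"
    and slab: "\<And>x. M / 2 ^ (DIM('a) + 4) \<le> f x \<Longrightarrow> \<bar>u \<bullet> (x - x1)\<bar> \<le> w"
  shows "(LINT x|lebesgue. (u \<bullet> (x - x1))\<^sup>2 * f x) \<le> 8 * w\<^sup>2"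
proof -
  \<comment> \<open>The exponent gives \<open>8 * \<delta> * 2 ^ DIM('a) = 1 / 2\<close>, where 8
    comes from the pointwise bound \<open>pw\<close> and \<open>2 ^ DIM('a)\<close> from
    substituting \<open>T\<close>. The last term is thus half of the moment and is absorbed.\<close>
  define \<delta> :: real where "\<delta> = 1 / 2 ^ (DIM('a) + 4)"
  have \<delta>: "0 \<le> \<delta>"
    by (simp add: \<delta>_def)
  define g where "g = (\<lambda>x. (u \<bullet> (x - x1))\<^sup>2 * f x)"
  define T where "T = (\<lambda>x. (1/2) *\<^sub>R x1 + (1/2) *\<^sub>R x)"
  have f0: "0 \<le> f x" for x
    by (rule log_concave_nonneg[OF f(1)])
  have g0: "0 \<le> g x" for x
    using f0 by (simp add: g_def)
  have pw: "g x \<le> 4 * w\<^sup>2 * f x + 8 * \<delta> * g (T x)" for x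
  proof (cases "\<bar>u \<bullet> (x - x1)\<bar> \<le> 2 * w")
    case True
    then have "(u \<bullet> (x - x1))\<^sup>2 \<le> (2 * w)\<^sup>2"
      by (metis abs_ge_zero power2_abs power_mono)
    then have "g x \<le> 4 * w\<^sup>2 * f x"
      using f0 by (auto simp: g_def power_mult_distrib intro!: mult_right_mono)
    moreover have "0 \<le> 8 * \<delta> * g (T x)"
      using g0 by (simp add: \<delta>_def)
    ultimately show ?thesis
      by linarith
  next
    case False
    have half: "u \<bullet> (x - x1) = 2 * (u \<bullet> (T x - x1))"
      by (simp add: T_def inner_diff_right inner_add_right)
    \<comment> \<open>Outside the doubled slab, \<open>T x\<close> is still outside the slab
      itself.\<close>
    have "f (T x) \<le> M * \<delta>"
      using slab[of "T x"] False half by (force simp: \<delta>_def)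
    have "f x * (M / 2) \<le> f x * f x1"
      using M f0 by (intro mult_left_mono) auto
    also have "\<dots> \<le> (f (midpoint x x1))\<^sup>2"
      by (rule log_concave_midpoint[OF f(1)])
    also have "midpoint x x1 = T x"
      by (simp add: midpoint_def T_def scaleR_add_right add.commute)
    also have "(f (T x))\<^sup>2 \<le> f (T x) * (M * \<delta>)"
      unfolding power2_eq_square using f0 \<open>f (T x) \<le> M * \<delta>\<close> by (rule mult_left_mono[rotated])
    finally have "f x \<le> 2 * \<delta> * f (T x)"
      using M by (simp add: field_simps)
    then have "g x \<le> (u \<bullet> (x - x1))\<^sup>2 * (2 * \<delta> * f (T x))"
      unfolding g_def by (intro mult_left_mono) auto
    also have "\<dots> = 8 * \<delta> * g (T x)"
      unfolding half g_def by (simp add: power2_eq_square)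
    finally show ?thesis
      using f0[of x] by (simp add: add_increasing)
  qed
  define J where "J = (LINT x|lebesgue. g x)"
  have J0: "0 \<le> J"
    using g0 by (simp add: J_def)
  have gint: "integrable lebesgue g"
    using int by (simp add: g_def)
  have gm: "(\<lambda>x. ennreal (g x)) \<in> borel_measurable lebesgue"
    using borel_measurable_integrable[OF gint] by simp
  have gJ: "(\<integral>\<^sup>+x. ennreal (g x) \<partial>lebesgue) = ennreal J"
    unfolding J_def by (rule nn_integral_eq_integral[OF gint]) (simp add: g0)
  have fI: "(\<integral>\<^sup>+x. ennreal (f x) \<partial>lebesgue) = 1"
    using nn_integral_eq_integral[OF f(2)] f(3) f0 by simp
  have gTm: "(\<lambda>x. ennreal (g (T x))) \<in> borel_measurable lebesgue"
    unfolding T_def by (rule measurable_affine_lebesgue[OF gm]) simp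
  have "ennreal J = ennreal ((1/2) ^ DIM('a)) * (\<integral>\<^sup>+x. ennreal (g (T x)) \<partial>lebesgue)"
    unfolding T_def gJ[symmetric] by (rule nn_integral_affine_lebesgue[OF gm]) simp
  then have "ennreal (2 ^ DIM('a)) * ennreal J =
      (ennreal (2 ^ DIM('a)) * ennreal ((1/2) ^ DIM('a))) * (\<integral>\<^sup>+x. ennreal (g (T x)) \<partial>lebesgue)"
    by (simp add: mult.assoc)
  also have "ennreal (2 ^ DIM('a)) * ennreal ((1/2) ^ DIM('a)) = 1"
    by (simp add: ennreal_mult[symmetric] power_mult_distrib[symmetric])
  finally have gTJ: "(\<integral>\<^sup>+x. ennreal (g (T x)) \<partial>lebesgue) = ennreal (2 ^ DIM('a) * J)"
    using J0 by (simp add: ennreal_mult)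
  have "ennreal J \<le> (\<integral>\<^sup>+x. ennreal (4 * w\<^sup>2) * ennreal (f x) + ennreal (8 * \<delta>) * ennreal (g (T x)) \<partial>lebesgue)"
    unfolding gJ[symmetric]
  proof (rule nn_integral_mono)
    fix x
    have "ennreal (g x) \<le> ennreal (4 * w\<^sup>2 * f x + 8 * \<delta> * g (T x))"
      by (rule ennreal_leI[OF pw])
    then show "ennreal (g x) \<le> ennreal (4 * w\<^sup>2) * ennreal (f x) + ennreal (8 * \<delta>) * ennreal (g (T x))"
      using f0[of x] g0[of "T x"] \<delta> by (simp add: ennreal_mult' ennreal_plus del: times_divide_eq_left)
  qed
  also have "\<dots> = ennreal (4 * w\<^sup>2) * 1 + ennreal (8 * \<delta>) * ennreal (2 ^ DIM('a) * J)"
    using borel_measurable_integrable[OF f(2)] gTm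
    by (simp add: nn_integral_add nn_integral_cmult fI gTJ)
  also have "\<dots> = ennreal (4 * w\<^sup>2 + 8 * \<delta> * (2 ^ DIM('a) * J))"
    using J0 \<delta> by (simp add: ennreal_mult' ennreal_plus del: times_divide_eq_left)
  finally have "J \<le> 4 * w\<^sup>2 + 8 * \<delta> * (2 ^ DIM('a) * J)"
    using J0 by (subst (asm) ennreal_le_iff) (auto simp: \<delta>_def)
  also have "8 * \<delta> * (2 ^ DIM('a) * J) = J / 2"
    by (simp add: \<delta>_def power_add)
  finally show ?thesis
    by (simp add: J_def g_def)
qed

section \<open>Simplices of nearly maximal determinant\<close>

text \<open>Termwise bound on the Leibniz formula; its purpose is to make a supremum of determinants
  finite.\<close>

lemma abs_det_le:
  fixes A :: "real^'n^'n"
  assumes "\<And>i. norm (A $ i) \<le> B"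
  shows "\<bar>det A\<bar> \<le> fact CARD('n) * B ^ CARD('n)"
proof -
  have ent: "\<bar>A $ i $ j\<bar> \<le> B" for i j
    using component_le_norm_cart[of "A $ i" j] assms[of i] by linarith
  have "\<bar>det A\<bar> \<le> (\<Sum>p\<in>{p. p permutes (UNIV :: 'n set)}. \<bar>of_int (sign p) * (\<Prod>i\<in>UNIV. A $ i $ p i)\<bar>)"
    unfolding det_def by (rule sum_abs)
  also have "\<dots> \<le> (\<Sum>p\<in>{p. p permutes (UNIV :: 'n set)}. B ^ CARD('n))"
  proof (rule sum_mono)
    fix p :: "'n \<Rightarrow> 'n"
    have "(\<Prod>i\<in>UNIV. \<bar>A $ i $ p i\<bar>) \<le> (\<Prod>i\<in>(UNIV :: 'n set). B)"
      using ent by (intro prod_mono) auto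
    moreover have "\<bar>of_int (sign p) :: real\<bar> = 1"
      by (simp add: sign_def)
    ultimately show "\<bar>of_int (sign p) * (\<Prod>i\<in>UNIV. A $ i $ p i)\<bar> \<le> B ^ CARD('n)"
      by (simp add: abs_mult abs_prod)
  qed
  also have "\<dots> = fact CARD('n) * B ^ CARD('n)"
    by (simp add: card_permutations)
  finally show ?thesis .
qed

text \<open>A basis chosen from \<open>K\<close> supplies the rows. It makes the supremum of the
  determinants positive.\<close>

lemma ex_matrix_rows_in_spanning:
  fixes K :: "(real^'n) set"
  assumes "span K = UNIV"
  obtains A :: "real^'n^'n" where "\<And>i. A $ i \<in> K" "det A \<noteq> 0"
proof -
  obtain B where B: "B \<subseteq> K" "independent B" "K \<subseteq> span B" "card B = dim K"
    using basis_exists[of K] by metis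
  have "card B = CARD('n)"
    using B(4) assms by (metis DIM_cart DIM_real dim_UNIV dim_span mult.right_neutral)
  moreover have "finite B"
    using B(2) by (rule independent_imp_finite)
  ultimately obtain b where b: "bij_betw b (UNIV :: 'n set) B"
    by (metis finite_same_card_bij finite)
  define A :: "real^'n^'n" where "A = (\<chi> i. b i)"
  have "rows A = B"
    using b by (auto simp: rows_def row_def A_def bij_betw_def)
  moreover have "span B = UNIV"
    using B assms by (metis span_eq span_span top.extremum_uniqueI span_mono span_subspace subspace_span)
  ultimately have "\<exists>C::real^'n^'n. C ** A = mat 1"
    by (simp add: matrix_left_invertible_span_rows)
  then have "det A \<noteq> 0"
    by (simp add: invertible_left_inverse[symmetric] invertible_det_nz[symmetric])
  moreover have "A $ i \<in> K" for i
    using b B(1) by (auto simp: A_def bij_betw_def)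
  ultimately show thesis
    using that by blast
qed

text \<open>Vectors in \<open>K\<close> whose determinant is at least half of the supremum: by Cramer's rule the
  coordinates of the points of \<open>K\<close> with respect to them are at most 2.\<close>

lemma ex_coordinates_le_2:
  fixes K :: "(real^'n) set"
  assumes K: "bounded K" and span: "span K = UNIV"
  obtains A W :: "real^'n^'n" where "\<And>i. A $ i \<in> K" "transpose A ** W = mat 1"
    "\<And>x i. x \<in> K \<Longrightarrow> \<bar>(W *v x) $ i\<bar> \<le> 2"
proof -
  let ?D = "{\<bar>det A\<bar> |A :: real^'n^'n. \<forall>i. A $ i \<in> K}"
  obtain B where "\<And>x. x \<in> K \<Longrightarrow> norm x \<le> B"
    using K by (auto simp: bounded_iff)
  then have bdd: "bdd_above ?D"
    by (intro bdd_aboveI[of _ "fact CARD('n) * B ^ CARD('n)"]) (auto intro!: abs_det_le)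
  obtain A0 :: "real^'n^'n" where A0: "\<And>i. A0 $ i \<in> K" "det A0 \<noteq> 0"
    using ex_matrix_rows_in_spanning[OF span] by blast
  have "\<bar>det A0\<bar> \<in> ?D"
    using A0 by blast
  then have "\<bar>det A0\<bar> \<le> Sup ?D"
    using bdd by (rule cSup_upper)
  \<comment> \<open>The supremum may not be attained, as \<open>K\<close> need not be closed;
    settling for half of it gives coordinates up to 2 instead of 1.\<close>
  then have "Sup ?D / 2 < Sup ?D"
    using A0(2) by linarith
  then obtain s where "s \<in> ?D" "Sup ?D / 2 < s"
    using less_cSupD[of ?D "Sup ?D / 2"] \<open>\<bar>det A0\<bar> \<in> ?D\<close> by blast
  then obtain A :: "real^'n^'n" where A: "\<And>i. A $ i \<in> K" "Sup ?D / 2 < \<bar>det A\<bar>"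
    by blast
  have detA: "det A \<noteq> 0"
    using A(2) \<open>\<bar>det A0\<bar> \<le> Sup ?D\<close> by auto
  then have "invertible (transpose A)"
    by (simp add: invertible_det_nz)
  then obtain W where W: "transpose A ** W = mat 1"
    by (auto simp: invertible_def)
  have "\<bar>(W *v x) $ k\<bar> \<le> 2" if x: "x \<in> K" for x k
  proof -
    define c where "c = W *v x"
    have "transpose A *v c = x"
      by (simp add: c_def matrix_vector_mul_assoc W)
    then have xs: "(\<Sum>i\<in>UNIV. c $ i *s row i A) = x"
      by (simp add: matrix_mult_sum column_transpose)
    let ?A' = "(\<chi> i. if i = k then x else row i A) :: real^'n^'n"
    \<comment> \<open>Replacing row \<open>k\<close> by \<open>x\<close> multiplies the determinant
      by \<open>c $ k\<close> and yields another competitor for the supremum.\<close>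
    have "det ?A' = c $ k * det A"
      using cramer_lemma_transpose[of k c A] unfolding xs by simp
    moreover have "\<bar>det ?A'\<bar> \<in> ?D"
      using A(1) x by (auto simp: row_def intro!: exI[of _ ?A'])
    then have "\<bar>det ?A'\<bar> \<le> Sup ?D"
      using bdd by (rule cSup_upper)
    ultimately have "\<bar>c $ k\<bar> * \<bar>det A\<bar> \<le> 2 * \<bar>det A\<bar>"
      using A(2) by (simp add: abs_mult)
    then show ?thesis
      using detA by (simp add: c_def)
  qed
  then show thesis
    using that A(1) W by blast
qed

text \<open>The rows of \<open>W\<close> are the coordinate functionals for the rows of
  \<open>A\<close>. With \<open>n = CARD('n)\<close>, the centre has all coordinates
  \<open>1 / (2 * n)\<close>, and a move by at most \<open>r\<close> changes each by at most as
  much. They stay between 0 and \<open>1 / n\<close>, so the point remains in the simplex spanned by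
  0 and the rows of \<open>A\<close>.\<close>

lemma cball_subset_convex_of_coordinates:
  fixes K :: "(real^'n) set" and A W :: "real^'n^'n"
  assumes K: "convex K" "0 \<in> K" and A: "\<And>i. A $ i \<in> K" "transpose A ** W = mat 1"
    and W: "\<And>i. norm (W $ i) * r \<le> 1 / (2 * real CARD('n))"
  shows "cball ((1 / (2 * real CARD('n))) *\<^sub>R (\<Sum>i\<in>UNIV. A $ i)) r \<subseteq> K"
proof
  define n where "n = real CARD('n)"
  have n: "0 < n"
    by (simp add: n_def)
  fix x assume x: "x \<in> cball ((1 / (2 * real CARD('n))) *\<^sub>R (\<Sum>i\<in>UNIV. A $ i)) r"
  define y where "y = x - (1 / (2 * n)) *\<^sub>R (\<Sum>i\<in>UNIV. A $ i)"
  have yr: "norm y \<le> r"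
    using x by (simp add: y_def n_def dist_norm norm_minus_commute)
  define c where "c = W *v y"
  have "transpose A *v c = y"
    by (simp add: c_def matrix_vector_mul_assoc A(2))
  then have ys: "y = (\<Sum>i\<in>UNIV. c $ i *\<^sub>R A $ i)"
    by (simp add: matrix_vector_column scalar_mult_eq_scaleR)
  have c: "\<bar>c $ i\<bar> \<le> 1 / (2 * n)" for i
  proof -
    have "\<bar>c $ i\<bar> = \<bar>W $ i \<bullet> y\<bar>"
      by (simp add: c_def matrix_vector_mul_component)
    also have "\<dots> \<le> norm (W $ i) * norm y"
      by (rule Cauchy_Schwarz_ineq2)
    also have "\<dots> \<le> norm (W $ i) * r"
      using yr by (rule mult_left_mono) simp
    finally show ?thesis
      using W[of i] by (simp add: n_def)
  qed
  \<comment> \<open>\<open>e i\<close> is \<open>n\<close> times the \<open>i\<close>-th coordinate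
    of \<open>x\<close>, so \<open>x\<close> is the average of the points
    \<open>e i *\<^sub>R A $ i\<close>, each on the segment from 0 to \<open>A $ i\<close>.\<close>
  define e where "e = (\<lambda>i. n * (1 / (2 * n) + c $ i))"
  have e: "0 \<le> e i" "e i \<le> 1" for i
  proof -
    have "\<bar>n * c $ i\<bar> \<le> 1 / 2"
      using mult_left_mono[OF c[of i], of n] n by (simp add: abs_mult)
    moreover have "e i = 1 / 2 + n * c $ i"
      using n by (simp add: e_def distrib_left)
    ultimately show "0 \<le> e i" "e i \<le> 1"
      by linarith+
  qed
  have "e i *\<^sub>R A $ i \<in> K" for i
  proof -
    have "(1 - e i) *\<^sub>R 0 + e i *\<^sub>R A $ i \<in> K"
      using K A(1) e[of i] by (intro convexD) auto
    then show ?thesis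
      by simp
  qed
  then have "(\<Sum>i\<in>UNIV. (1 / n) *\<^sub>R (e i *\<^sub>R A $ i)) \<in> K"
    using n by (intro convex_sum K) (auto simp: n_def)
  also have "(\<Sum>i\<in>UNIV. (1 / n) *\<^sub>R (e i *\<^sub>R A $ i)) = (\<Sum>i\<in>UNIV. (1 / (2 * n)) *\<^sub>R A $ i + c $ i *\<^sub>R A $ i)"
    using n by (intro sum.cong refl) (simp add: e_def scaleR_add_left[symmetric])
  also have "\<dots> = (1 / (2 * n)) *\<^sub>R (\<Sum>i\<in>UNIV. A $ i) + y"
    by (simp add: sum.distrib ys scaleR_sum_right)
  also have "\<dots> = x"
    by (simp add: y_def)
  finally show "x \<in> K" .
qed

section \<open>Moments of an isotropic density\<close>

context
  fixes f :: "real ^ 'n \<Rightarrow> real" and \<sigma> :: real and m :: "real ^ 'n"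
  assumes dens: "is_density f" and iso: "isotropic_with \<sigma> f"
  defines "m \<equiv> density_mean f"
begin

text \<open>\<open>isotropic_with\<close> only prescribes values of integrals. On the diagonal they
  converge, because a divergent one would count as 0 and not as \<open>\<sigma>\<^sup>2\<close>; off
  the diagonal, \<open>\<bar>a * b\<bar> \<le> a * a + b * b\<close> dominates.\<close>

lemma isotropic_second_moments:
  "has_bochner_integral lebesgue (\<lambda>x. (x $ i - m $ i) * (x $ j - m $ j) * f x) (if i = j then \<sigma>\<^sup>2 else 0)"
proof -
  have f: "integrable lebesgue f" "\<And>x. 0 \<le> f x"
    using dens by (auto simp: is_density_def)
  have fm[measurable]: "f \<in> borel_measurable lebesgue"
    using f(1) by auto
  have comp[measurable]: "(\<lambda>x::real^'n. x $ k) \<in> borel_measurable lebesgue" for k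
    by (rule measurable_completion) simp
  have cov: "(LINT x|lebesgue. (x $ i - m $ i) * (x $ j - m $ j) * f x) = (if i = j then \<sigma>\<^sup>2 else 0)" for i j
  proof -
    have "covariance_matrix f $ i $ j = (\<sigma>\<^sup>2 *\<^sub>R mat 1 :: real^'n^'n) $ i $ j"
      using iso by (simp add: isotropic_with_def)
    then show ?thesis
      by (simp add: covariance_matrix_def mat_def m_def)
  qed
  have "\<sigma> \<noteq> 0"
    using iso by (simp add: isotropic_with_def)
  then have diag: "integrable lebesgue (\<lambda>x. (x $ k - m $ k) * (x $ k - m $ k) * f x)" for k
    using cov[of k k] not_integrable_integral_eq by fastforce
  have "integrable lebesgue (\<lambda>x. (x $ i - m $ i) * (x $ j - m $ j) * f x)"
  proof (rule Bochner_Integration.integrable_bound)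
    show "integrable lebesgue (\<lambda>x. (x $ i - m $ i) * (x $ i - m $ i) * f x + (x $ j - m $ j) * (x $ j - m $ j) * f x)"
      by (intro Bochner_Integration.integrable_add diag)
    show "AE x in lebesgue. norm ((x $ i - m $ i) * (x $ j - m $ j) * f x)
        \<le> norm ((x $ i - m $ i) * (x $ i - m $ i) * f x + (x $ j - m $ j) * (x $ j - m $ j) * f x)"
    proof (rule AE_I2)
      fix x
      have "\<bar>a * b\<bar> \<le> a * a + b * b" for a b :: real
      proof -
        have "0 \<le> (\<bar>a\<bar> - \<bar>b\<bar>)\<^sup>2" "0 \<le> \<bar>a\<bar> * \<bar>b\<bar>"
          by auto
        then show ?thesis
          using mult.commute[of "\<bar>b\<bar>" "\<bar>a\<bar>"]
          unfolding power2_eq_square abs_mult left_diff_distrib right_diff_distrib abs_mult_self_eq by linarith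
      qed
      from mult_right_mono[OF this[of "x $ i - m $ i" "x $ j - m $ j"] f(2)[of x]]
      show "norm ((x $ i - m $ i) * (x $ j - m $ j) * f x)
        \<le> norm ((x $ i - m $ i) * (x $ i - m $ i) * f x + (x $ j - m $ j) * (x $ j - m $ j) * f x)"
        using f(2)[of x] by (simp add: abs_mult distrib_right)
    qed
  qed measurable
  then show ?thesis
    by (simp add: has_bochner_integral_iff cov)
qed

text \<open>Integrability comes from \<open>\<bar>a\<bar> \<le> a * a + 1\<close> and the second
  moments; the value is 0 because \<open>m\<close> is the mean.\<close>

lemma isotropic_first_moments: "has_bochner_integral lebesgue (\<lambda>x. (x $ i - m $ i) * f x) 0"
proof -
  have f: "integrable lebesgue f" "\<And>x. 0 \<le> f x" "(LINT x|lebesgue. f x) = 1"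
    using dens by (auto simp: is_density_def)
  have fm[measurable]: "f \<in> borel_measurable lebesgue"
    using f(1) by auto
  have comp[measurable]: "(\<lambda>x::real^'n. x $ k) \<in> borel_measurable lebesgue" for k
    by (rule measurable_completion) simp
  have int: "integrable lebesgue (\<lambda>x. (x $ i - m $ i) * f x)"
  proof (rule Bochner_Integration.integrable_bound)
    show "integrable lebesgue (\<lambda>x. (x $ i - m $ i) * (x $ i - m $ i) * f x + f x)"
      using isotropic_second_moments[of i i] by (intro Bochner_Integration.integrable_add f) (simp add: has_bochner_integral_iff)
    show "AE x in lebesgue. norm ((x $ i - m $ i) * f x) \<le> norm ((x $ i - m $ i) * (x $ i - m $ i) * f x + f x)"
    proof (rule AE_I2)
      fix x
      have "\<bar>a\<bar> \<le> a * a + 1" for a :: real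
      proof -
        have "0 \<le> (\<bar>a\<bar> - 1)\<^sup>2" "0 \<le> \<bar>a\<bar>"
          by auto
        then show ?thesis
          by (simp add: power2_eq_square algebra_simps)
      qed
      from mult_right_mono[OF this[of "x $ i - m $ i"] f(2)[of x]]
      show "norm ((x $ i - m $ i) * f x) \<le> norm ((x $ i - m $ i) * (x $ i - m $ i) * f x + f x)"
        using f(2)[of x] by (simp add: abs_mult distrib_right)
    qed
  qed measurable
  have "integrable lebesgue (\<lambda>x. (x $ i - m $ i) * f x + m $ i * f x)"
    using int f(1) by auto
  then have "(LINT x|lebesgue. x $ i * f x) = (LINT x|lebesgue. (x $ i - m $ i) * f x + m $ i * f x)"
    by (simp add: algebra_simps)
  also have "\<dots> = (LINT x|lebesgue. (x $ i - m $ i) * f x) + m $ i"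
    using int f by simp
  finally have "(LINT x|lebesgue. (x $ i - m $ i) * f x) = 0"
    by (simp add: m_def density_mean_def)
  then show ?thesis
    using int by (simp add: has_bochner_integral_iff)
qed

text \<open>Split \<open>u \<bullet> (x - q)\<close> at the mean: the cross term vanishes and the
  shift adds its square. Hence the moment about any \<open>q\<close> is at least the variance in
  direction \<open>u\<close>.\<close>

lemma isotropic_directional_moment:
  "has_bochner_integral lebesgue (\<lambda>x. (u \<bullet> (x - q))\<^sup>2 * f x) (\<sigma>\<^sup>2 * (norm u)\<^sup>2 + (u \<bullet> (m - q))\<^sup>2)"
proof -
  let ?c = "u \<bullet> (m - q)"
  have f: "has_bochner_integral lebesgue f 1"
    using dens by (auto simp: is_density_def has_bochner_integral_iff)
  have "has_bochner_integral lebesgue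
     (\<lambda>x. (\<Sum>i\<in>UNIV. \<Sum>j\<in>UNIV. (u $ i * u $ j) * ((x $ i - m $ i) * (x $ j - m $ j) * f x)) +
       (\<Sum>i\<in>UNIV. (2 * ?c * u $ i) * ((x $ i - m $ i) * f x)) + ?c\<^sup>2 * f x)
     ((\<Sum>i\<in>UNIV. \<Sum>j\<in>UNIV. (u $ i * u $ j) * (if i = j then \<sigma>\<^sup>2 else 0)) +
       (\<Sum>i\<in>UNIV. (2 * ?c * u $ i) * 0) + ?c\<^sup>2 * 1)"
    by (intro has_bochner_integral_add has_bochner_integral_sum has_bochner_integral_mult_right
        isotropic_second_moments isotropic_first_moments f)
  also have "(\<lambda>x. (\<Sum>i\<in>UNIV. \<Sum>j\<in>UNIV. (u $ i * u $ j) * ((x $ i - m $ i) * (x $ j - m $ j) * f x)) +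
       (\<Sum>i\<in>UNIV. (2 * ?c * u $ i) * ((x $ i - m $ i) * f x)) + ?c\<^sup>2 * f x) = (\<lambda>x. (u \<bullet> (x - q))\<^sup>2 * f x)"
  proof
    fix x
    define s where "s = (\<Sum>i\<in>UNIV. u $ i * (x $ i - m $ i))"
    have E1: "s * s * f x = (\<Sum>i\<in>UNIV. \<Sum>j\<in>UNIV. (u $ i * u $ j) * ((x $ i - m $ i) * (x $ j - m $ j) * f x))"
      by (simp only: s_def sum_product) (simp add: sum_distrib_left sum_distrib_right mult_ac)
    have E2: "2 * ?c * s * f x = (\<Sum>i\<in>UNIV. (2 * ?c * u $ i) * ((x $ i - m $ i) * f x))"
      unfolding s_def sum_distrib_right sum_distrib_left by (intro sum.cong refl) (simp add: mult_ac)
    have E3: "u \<bullet> (x - q) = s + ?c"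
      by (simp add: s_def inner_vec_def sum.distrib[symmetric] algebra_simps)
    show "(\<Sum>i\<in>UNIV. \<Sum>j\<in>UNIV. (u $ i * u $ j) * ((x $ i - m $ i) * (x $ j - m $ j) * f x)) +
       (\<Sum>i\<in>UNIV. (2 * ?c * u $ i) * ((x $ i - m $ i) * f x)) + ?c\<^sup>2 * f x = (u \<bullet> (x - q))\<^sup>2 * f x"
      unfolding E1[symmetric] E2[symmetric] E3 by (simp add: power2_eq_square algebra_simps)
  qed
  also have "(\<Sum>i\<in>UNIV. \<Sum>j\<in>UNIV. (u $ i * u $ j) * (if i = j then \<sigma>\<^sup>2 else 0)) = \<sigma>\<^sup>2 * (norm u)\<^sup>2"
    by (simp add: if_distrib sum.delta power2_norm_eq_inner inner_vec_def sum_distrib_left mult_ac cong: if_cong)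
  finally show ?thesis
    by simp
qed

lemma integrable_norm_sq_mult: "integrable lebesgue (\<lambda>x. (norm (x - m))\<^sup>2 * f x)"
proof -
  have "integrable lebesgue (\<lambda>x. \<Sum>i\<in>UNIV. (x $ i - m $ i) * (x $ i - m $ i) * f x)"
    using isotropic_second_moments by (intro Bochner_Integration.integrable_sum) (simp add: has_bochner_integral_iff)
  also have "(\<lambda>x. \<Sum>i\<in>UNIV. (x $ i - m $ i) * (x $ i - m $ i) * f x) = (\<lambda>x. (norm (x - m))\<^sup>2 * f x)"
    unfolding power2_norm_eq_inner by (simp add: inner_vec_def sum_distrib_right)
  finally show ?thesis .
qed

end

section \<open>A ball of radius proportional to \<sigma> in a superlevel set\<close>

lemma ex_large_cball_superlevel:
  fixes f :: "real ^ 'n \<Rightarrow> real"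
  assumes dens: "is_density f" and lc: "log_concave f" and iso: "isotropic_with \<sigma> f"
  obtains x0 a where "0 < a" "\<And>x. f x \<le> 2 ^ (CARD('n) + 4) * a"
    "\<And>x. x \<in> cball x0 (\<sigma> / (12 * real CARD('n))) \<Longrightarrow> a \<le> f x"
proof -
  have f: "integrable lebesgue f" "\<And>x. 0 \<le> f x" "(LINT x|lebesgue. f x) = 1"
    using dens by (auto simp: is_density_def)
  have \<sigma>: "0 < \<sigma>"
    using iso by (simp add: isotropic_with_def)
  define M where "M = Sup (range f)"
  have le_M: "f x \<le> M" for x
    unfolding M_def using log_concave_bounded_above[OF lc f(1)] f(3) by (intro cSup_upper) auto
  have M: "0 < M"
  proof (rule ccontr)
    assume "\<not> 0 < M"
    then have "f x = 0" for x
      using le_M[of x] f(2)[of x] by linarith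
    then have "f = (\<lambda>x. 0)"
      by blast
    then show False
      using f(3) by simp
  qed
  then have "M / 2 < Sup (range f)"
    unfolding M_def by simp
  \<comment> \<open>A point above half of the supremum suffices for the slab estimate; a maximiser
    might not exist.\<close>
  then obtain x1 where x1: "M / 2 < f x1"
    by (rule less_cSupE) auto
  define a where "a = M / 2 ^ (CARD('n) + 4)"
  have a: "0 < a"
    using M by (simp add: a_def)
  \<comment> \<open>The superlevel set, translated so that \<open>x1\<close> becomes the origin and
    a vertex of the simplex.\<close>
  define K where "K = (\<lambda>x. x - x1) ` {x. a \<le> f x}"
  have K_iff: "z \<in> K \<longleftrightarrow> a \<le> f (x1 + z)" for z
    by (force simp: K_def)
  have slab: "\<sigma>\<^sup>2 * (norm u)\<^sup>2 \<le> 8 * w\<^sup>2" if u: "\<And>z. z \<in> K \<Longrightarrow> \<bar>u \<bullet> z\<bar> \<le> w" for u w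
  proof -
    have mom: "has_bochner_integral lebesgue (\<lambda>x. (u \<bullet> (x - x1))\<^sup>2 * f x)
        (\<sigma>\<^sup>2 * (norm u)\<^sup>2 + (u \<bullet> (density_mean f - x1))\<^sup>2)"
      by (rule isotropic_directional_moment[OF dens iso])
    have "(LINT x|lebesgue. (u \<bullet> (x - x1))\<^sup>2 * f x) \<le> 8 * w\<^sup>2"
    proof (rule second_moment_le_of_slab[OF lc f(1,3)])
      show "\<bar>u \<bullet> (x - x1)\<bar> \<le> w" if "M / 2 ^ (DIM(real ^ 'n) + 4) \<le> f x" for x
        using that by (intro u) (simp add: K_iff a_def)
    qed (use mom M x1 in \<open>auto simp: has_bochner_integral_iff\<close>)
    then show ?thesis
      using mom by (simp add: has_bochner_integral_iff) (smt (verit) zero_le_power2)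
  qed
  have "bounded K"
    unfolding K_def
    using bounded_superlevel[OF lc _ integrable_norm_sq_mult[OF dens iso] a] f(3)
    by (simp add: bounded_translation_minus)
  have "convex K"
    unfolding K_def using convex_superlevel[OF lc a] by (simp add: convex_translation_subtract)
  have "1 \<le> (2::real) ^ (CARD('n) + 3)"
    by simp
  then have "a \<le> M / 2"
    using M by (simp add: a_def power_add field_simps)
  then have "0 \<in> K"
    using x1 by (simp add: K_iff)
  \<comment> \<open>Otherwise \<open>K\<close> lies in a hyperplane through 0, a slab with
    \<open>w = 0\<close>, which contradicts \<open>slab\<close>.\<close>
  have "span K = UNIV"
  proof (rule ccontr)
    assume "span K \<noteq> UNIV"
    then obtain u where u: "u \<noteq> 0" "span K \<subseteq> {x. u \<bullet> x = 0}"
      using span_not_univ_subset_hyperplane by blast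
    then have "\<bar>u \<bullet> z\<bar> \<le> 0" if "z \<in> K" for z
      using span_base[OF that] by auto
    from slab[OF this] have "\<sigma>\<^sup>2 * (norm u)\<^sup>2 \<le> 0"
      by simp
    then show False
      using u(1) \<sigma> by (simp add: mult_le_0_iff)
  qed
  obtain A W :: "real^'n^'n" where A: "\<And>i. A $ i \<in> K" "transpose A ** W = mat 1"
    and W: "\<And>x i. x \<in> K \<Longrightarrow> \<bar>(W *v x) $ i\<bar> \<le> 2"
    using ex_coordinates_le_2[OF \<open>bounded K\<close> \<open>span K = UNIV\<close>] by blast
  have "norm (W $ i) * (\<sigma> / (12 * real CARD('n))) \<le> 1 / (2 * real CARD('n))" for i
  proof -
    \<comment> \<open>The coordinate bound 2 makes \<open>K\<close> a slab for \<open>W $ i\<close>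
      with \<open>w = 2\<close>. Rounding 32 up to 36 gives the 6, hence the 12 in the
      radius.\<close>
    have "(\<sigma> * norm (W $ i))\<^sup>2 \<le> 8 * 2\<^sup>2"
      unfolding power_mult_distrib by (rule slab) (use W in \<open>simp add: matrix_vector_mul_component\<close>)
    then have "(\<sigma> * norm (W $ i))\<^sup>2 \<le> 6\<^sup>2"
      by simp
    then have "\<sigma> * norm (W $ i) \<le> 6"
      by (rule power2_le_imp_le) simp
    then show ?thesis
      by (simp add: field_simps)
  qed
  from cball_subset_convex_of_coordinates[OF \<open>convex K\<close> \<open>0 \<in> K\<close> A this]
  have "cball ((1 / (2 * real CARD('n))) *\<^sub>R (\<Sum>i\<in>UNIV. A $ i)) (\<sigma> / (12 * real CARD('n))) \<subseteq> K" (is "cball ?b ?r \<subseteq> K") .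
  then have "a \<le> f x" if "x \<in> cball (x1 + ?b) ?r" for x
    using that K_iff[of "x - x1"] by (force simp: dist_norm algebra_simps)
  moreover have "f x \<le> 2 ^ (CARD('n) + 4) * a" for x
    using le_M[of x] by (simp add: a_def)
  ultimately show thesis
    using that[OF a] by blast
qed

section \<open>Comparison of the lattice sum with the integral\<close>

text \<open>Every point of \<open>cball x0 r\<close> is available as the second end of the segment, so a displacement
  of \<open>\<eta> * r\<close> is absorbed at the cost of the factor \<open>B powr \<eta>\<close>.\<close>

lemma log_concave_le_contraction:
  fixes f :: "'a::real_normed_vector \<Rightarrow> real"
  assumes f: "log_concave f" and a: "0 < a" and B: "0 < B" "\<And>x. f x \<le> B * a"
    and ball: "\<And>x. x \<in> cball x0 r \<Longrightarrow> a \<le> f x"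
    and \<eta>: "0 < \<eta>" "\<eta> < 1" and w: "dist w (\<eta> *\<^sub>R x0 + (1 - \<eta>) *\<^sub>R y) \<le> \<eta> * r"
  shows "f y \<le> B powr \<eta> * f w"
proof -
  have f0: "0 \<le> f x" for x
    by (rule log_concave_nonneg[OF f])
  define v where "v = w - (\<eta> *\<^sub>R x0 + (1 - \<eta>) *\<^sub>R y)"
  \<comment> \<open>Chosen so that \<open>w\<close> divides the segment from \<open>y\<close> to
    \<open>z\<close>; the displacement \<open>v\<close>, magnified by \<open>1 / \<eta>\<close>,
    stays within \<open>r\<close>.\<close>
  define z where "z = x0 + (1 / \<eta>) *\<^sub>R v"
  have "norm v \<le> \<eta> * r"
    using w by (simp add: v_def dist_norm)
  then have "a \<le> f z"
    using \<eta> by (intro ball) (simp add: z_def dist_norm field_simps)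
  have "(1 - \<eta>) *\<^sub>R y + \<eta> *\<^sub>R z = w"
    using \<eta> by (simp add: z_def v_def scaleR_add_right)
  then have le_w: "f y powr (1 - \<eta>) * f z powr \<eta> \<le> f w"
    using log_concaveD[OF f, of \<eta> y z] \<eta> by simp
  have "f y = f y powr (1 - \<eta>) * f y powr \<eta>"
    using f0[of y] by (simp add: powr_add[symmetric])
  also have "\<dots> \<le> f y powr (1 - \<eta>) * (B * a) powr \<eta>"
    using B(2) f0 \<eta> by (intro mult_left_mono powr_mono2) auto
  also have "\<dots> = B powr \<eta> * (f y powr (1 - \<eta>) * a powr \<eta>)"
    using a B by (simp add: powr_mult)
  also have "\<dots> \<le> B powr \<eta> * (f y powr (1 - \<eta>) * f z powr \<eta>)"
    using a \<open>a \<le> f z\<close> \<eta> by (intro mult_left_mono powr_mono2) auto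
  also have "\<dots> \<le> B powr \<eta> * f w"
    using le_w by (intro mult_left_mono) auto
  finally show ?thesis .
qed

text \<open>\<open>Q\<close> joins the loss \<open>B powr \<eta>\<close> of the contraction
  inequality to the Jacobian of the contraction. Working with extended nonnegative integrals lets
  summability follow from the upper bound.\<close>

lemma lattice_sum_bounds:
  fixes f :: "real ^ 'n \<Rightarrow> real"
  assumes dens: "is_density f" and lc: "log_concave f" and a: "0 < a" and B: "0 < B" "\<And>x. f x \<le> B * a"
    and ball: "\<And>x. x \<in> cball x0 r \<Longrightarrow> a \<le> f x"
    and \<eta>: "0 < \<eta>" "\<eta> < 1" "sqrt (real CARD('n)) \<le> \<eta> * r"
  defines "Q \<equiv> B powr \<eta> / (1 - \<eta>) ^ CARD('n)"
  shows "f summable_on integer_lattice" "infsum f integer_lattice \<le> Q" "1 \<le> Q * infsum f integer_lattice"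
proof -
  define S where "S = (\<lambda>x. \<eta> *\<^sub>R x0 + (1 - \<eta>) *\<^sub>R x)"
  define D where "D = (1 - \<eta>) ^ CARD('n)"
  define b where "b = B powr \<eta>"
  have pos: "0 < D" "0 < b"
    using \<eta> B by (auto simp: D_def b_def)
  have f: "integrable lebesgue f" "\<And>x. 0 \<le> f x" "(LINT x|lebesgue. f x) = 1"
    using dens by (auto simp: is_density_def)
  have fm: "(\<lambda>x. ennreal (f x)) \<in> borel_measurable lebesgue"
    using borel_measurable_integrable[OF f(1)] by simp
  have floor_m: "(\<lambda>x. ennreal (f (vec_floor x))) \<in> borel_measurable lebesgue"
    by (rule measurable_comp_vec_floor)
  have le: "f y \<le> b * f w" if "dist w (S y) \<le> \<eta> * r" for y w
    using log_concave_le_contraction[OF lc a B ball \<eta>(1,2), where w = w and y = y] that by (simp add: S_def b_def)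
  have scale: "(\<integral>\<^sup>+x. g x \<partial>lebesgue) = ennreal D * (\<integral>\<^sup>+x. g (S x) \<partial>lebesgue)"
    if "g \<in> borel_measurable lebesgue" for g :: "real ^ 'n \<Rightarrow> ennreal"
    using nn_integral_affine_lebesgue[OF that, of "1 - \<eta>" "\<eta> *\<^sub>R x0"] \<eta> by (simp add: S_def D_def)
  have scaled_m: "(\<lambda>x. g (S x)) \<in> borel_measurable lebesgue"
    if "g \<in> borel_measurable lebesgue" for g :: "real ^ 'n \<Rightarrow> ennreal"
    unfolding S_def by (rule measurable_affine_lebesgue[OF that]) (use \<eta> in simp)
  have fI: "(\<integral>\<^sup>+x. ennreal (f x) \<partial>lebesgue) = 1"
    using nn_integral_eq_integral[OF f(1)] f(2,3) by simp
  define s where "s = (\<integral>\<^sup>+k. ennreal (f k) \<partial>count_space integer_lattice)"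
  have s: "s = (\<integral>\<^sup>+x. ennreal (f (vec_floor x)) \<partial>lebesgue)"
    unfolding s_def by (rule nn_integral_vec_floor[symmetric])
  \<comment> \<open>Round first, then contract: \<open>S (vec_floor x)\<close> is within
    \<open>\<eta> * r\<close> of \<open>S x\<close>.\<close>
  have "s \<le> (\<integral>\<^sup>+x. ennreal b * ennreal (f (S x)) \<partial>lebesgue)"
    unfolding s
  proof (rule nn_integral_mono)
    fix x
    have "dist (S x) (S (vec_floor x)) = (1 - \<eta>) * norm (x - vec_floor x)"
      using \<eta> by (simp add: S_def dist_norm scaleR_diff_right[symmetric])
    also have "\<dots> \<le> 1 * sqrt (real CARD('n))"
      using \<eta> by (intro mult_mono norm_diff_vec_floor_le) auto
    finally show "ennreal (f (vec_floor x)) \<le> ennreal b * ennreal (f (S x))"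
      using le[of "S x" "vec_floor x"] \<eta> f(2) pos by (simp add: ennreal_mult'[symmetric] ennreal_leI)
  qed
  also have "\<dots> = ennreal b * (\<integral>\<^sup>+x. ennreal (f (S x)) \<partial>lebesgue)"
    by (rule nn_integral_cmult[OF scaled_m[OF fm]])
  finally have "ennreal D * s \<le> ennreal b * (ennreal D * (\<integral>\<^sup>+x. ennreal (f (S x)) \<partial>lebesgue))"
    by (simp add: mult_left_mono mult.left_commute)
  then have upper: "ennreal D * s \<le> ennreal b"
    by (simp add: scale[OF fm, symmetric] fI)
  \<comment> \<open>Contract first, then round: \<open>vec_floor (S y)\<close> is within
    \<open>\<eta> * r\<close> of \<open>S y\<close>.\<close>
  have "1 \<le> (\<integral>\<^sup>+y. ennreal b * ennreal (f (vec_floor (S y))) \<partial>lebesgue)"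
    unfolding fI[symmetric]
  proof (rule nn_integral_mono)
    fix y
    have "dist (vec_floor (S y)) (S y) \<le> \<eta> * r"
      using norm_diff_vec_floor_le[of "S y"] \<eta>(3) by (simp add: dist_norm norm_minus_commute)
    then show "ennreal (f y) \<le> ennreal b * ennreal (f (vec_floor (S y)))"
      using le[of "vec_floor (S y)" y] f(2) pos by (simp add: ennreal_mult'[symmetric] ennreal_leI)
  qed
  also have "\<dots> = ennreal b * (\<integral>\<^sup>+y. ennreal (f (vec_floor (S y))) \<partial>lebesgue)"
    by (rule nn_integral_cmult[OF scaled_m[OF floor_m]])
  finally have "ennreal D * 1 \<le> ennreal D * (ennreal b * (\<integral>\<^sup>+y. ennreal (f (vec_floor (S y))) \<partial>lebesgue))"
    by (rule mult_left_mono) simp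
  then have lower: "ennreal D \<le> ennreal b * s"
    by (simp add: s scale[OF floor_m] mult.left_commute)
  have "s \<noteq> \<infinity>"
    using upper pos by (auto simp: ennreal_mult_top top_unique)
  then have int: "integrable (count_space integer_lattice) f"
    using f(2) by (intro integrableI_nonneg) (auto simp: s_def less_top)
  then have abs: "Infinite_Set_Sum.abs_summable_on f integer_lattice"
    by (simp add: abs_summable_on_def)
  then show "f summable_on integer_lattice"
    using abs_summable_equivalent[of f integer_lattice] f(2) by simp
  have "infsum f integer_lattice = (LINT k|count_space integer_lattice. f k)"
    using infsetsum_infsum[OF abs] by (simp add: infsetsum_def)
  then have s_eq: "s = ennreal (infsum f integer_lattice)"
    unfolding s_def using nn_integral_eq_integral[OF int] f(2) by simp
  have s0: "0 \<le> infsum f integer_lattice"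
    by (rule infsum_nonneg) (rule f(2))
  have "D * infsum f integer_lattice \<le> b"
    using upper pos s0 by (simp add: s_eq ennreal_mult'[symmetric])
  then show "infsum f integer_lattice \<le> Q"
    using pos by (simp add: Q_def D_def[symmetric] b_def[symmetric] field_simps)
  have "D \<le> b * infsum f integer_lattice"
    using lower pos s0 by (simp add: s_eq ennreal_mult'[symmetric])
  then show "1 \<le> Q * infsum f integer_lattice"
    using pos by (simp add: Q_def D_def[symmetric] b_def[symmetric] field_simps)
qed

section \<open>Choice of constants and the error of order 1/\<sigma>\<close>

text \<open>Turns the Jacobian factor into an exponential that merges with
  \<open>B powr \<eta>\<close>.\<close>

lemma inverse_one_minus_le_exp:
  assumes "0 \<le> \<eta>" "\<eta> \<le> 1 / 2"
  shows "1 / (1 - \<eta>) \<le> exp (2 * \<eta> :: real)"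
proof -
  have "0 \<le> \<eta> * (1 - 2 * \<eta>)"
    using assms by simp
  then have "1 / (1 - \<eta>) \<le> 1 + 2 * \<eta>"
    using assms by (simp add: divide_le_eq algebra_simps)
  also have "\<dots> \<le> exp (2 * \<eta>)"
    by (rule exp_ge_add_one_self)
  finally show ?thesis .
qed

text \<open>The dimension is \<open>CARD('n)\<close>, which is at least 1. Summability is asserted
  as well, since \<open>infsum\<close> is 0 by default on families that are not summable.\<close>

theorem proposition26:
  shows "\<exists>C N :: real. 0 < C \<and> 0 < N \<and>
    (\<forall>(f :: real ^ 'n \<Rightarrow> real) \<sigma>.
       is_density f \<longrightarrow> log_concave f \<longrightarrow> isotropic_with \<sigma> f \<longrightarrow> N \<le> \<sigma> \<longrightarrow>
         f summable_on integer_lattice \<and>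
         \<bar>(LINT x|lebesgue. f x) - (\<Sum>\<^sub>\<infinity>k\<in>integer_lattice. f k)\<bar> \<le> C / \<sigma>)"
proof -
  define n where "n = real CARD('n)"
  define B :: real where "B = 2 ^ (CARD('n) + 4)"
  \<comment> \<open>With \<open>\<eta> = k / \<sigma>\<close> and radius
    \<open>\<sigma> / (12 * n)\<close>, their product is exactly \<open>sqrt n\<close>;
    \<open>c\<close> collects the exponents in \<open>Q \<le> exp (\<eta> * c)\<close>.\<close>
  define k where "k = 12 * n * sqrt n"
  define c where "c = ln B + 2 * n"
  have n: "0 < n" and B: "1 < B"
    by (auto simp: n_def B_def intro!: one_less_power)
  have k: "0 < k" and c: "0 < c"
    using n B by (auto simp: k_def c_def intro: add_pos_pos)
  have "f summable_on integer_lattice \<and>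
      \<bar>(LINT x|lebesgue. f x) - infsum f integer_lattice\<bar> \<le> (2 * k * c) / \<sigma>"
    if f: "is_density f" "log_concave f" "isotropic_with \<sigma> f" and \<sigma>: "2 * k * (1 + c) \<le> \<sigma>"
    for f :: "real ^ 'n \<Rightarrow> real" and \<sigma>
  proof -
    have "0 < 2 * k * (1 + c)"
      using k c by simp
    then have \<sigma>0: "0 < \<sigma>"
      using \<sigma> by linarith
    define \<eta> where "\<eta> = k / \<sigma>"
    have \<eta>0: "0 < \<eta>"
      using k \<sigma>0 by (simp add: \<eta>_def)
    \<comment> \<open>The threshold for \<open>\<sigma>\<close> is made for this: it bounds both
      \<open>\<eta>\<close> and \<open>\<eta> * c\<close> by 1/2.\<close>
    have "\<eta> * (1 + c) \<le> 1 / 2"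
      using \<sigma> \<sigma>0 by (simp add: \<eta>_def field_simps)
    moreover have "0 < \<eta> * c"
      using \<eta>0 c by simp
    ultimately have \<eta>: "\<eta> \<le> 1 / 2" "\<eta> * c \<le> 1 / 2"
      using \<eta>0 unfolding distrib_left by linarith+
    obtain x0 a where a: "0 < a" "\<And>x. f x \<le> B * a"
      and ball: "\<And>x. x \<in> cball x0 (\<sigma> / (12 * n)) \<Longrightarrow> a \<le> f x"
      using ex_large_cball_superlevel[OF f] unfolding B_def n_def by metis
    define Q where "Q = B powr \<eta> / (1 - \<eta>) ^ CARD('n)"
    have "\<eta> * (\<sigma> / (12 * n)) = sqrt n"
      using \<sigma>0 n by (simp add: \<eta>_def k_def)
    then have "sqrt (real CARD('n)) \<le> \<eta> * (\<sigma> / (12 * n))"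
      by (simp add: n_def)
    note sum = lattice_sum_bounds[OF f(1,2) a(1) _ a(2) ball \<eta>0 _ this, folded Q_def]
    define s where "s = infsum f integer_lattice"
    have summ: "f summable_on integer_lattice" and s: "s \<le> Q" "1 \<le> Q * s"
      unfolding s_def using B \<eta> by (auto intro!: sum)
    have "Q = B powr \<eta> * (1 / (1 - \<eta>)) ^ CARD('n)"
      by (simp add: Q_def power_divide)
    also have "\<dots> \<le> B powr \<eta> * exp (2 * \<eta>) ^ CARD('n)"
      using \<eta> \<eta>0 by (intro mult_left_mono power_mono inverse_one_minus_le_exp) auto
    also have "\<dots> = exp (\<eta> * c)"
      using B by (simp add: powr_def c_def n_def exp_of_nat_mult[symmetric] exp_add[symmetric] algebra_simps)
    also have "\<dots> \<le> 1 + 2 * (\<eta> * c)"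
      using exp_bound_lemma[of "\<eta> * c"] \<eta>(2) \<open>0 < \<eta> * c\<close> by simp
    finally have Q: "Q - 1 \<le> 2 * k * c / \<sigma>"
      by (simp add: \<eta>_def)
    have "0 < Q"
      using B \<eta> by (simp add: Q_def)
    \<comment> \<open>This gives \<open>2 - Q \<le> 1 / Q\<close>, so the lower bound
      \<open>1 / Q\<close> for \<open>s\<close> deviates from 1 by no more than the upper bound
      \<open>Q\<close>.\<close>
    have "0 \<le> (Q - 1)\<^sup>2"
      by simp
    then have "Q * (2 - Q) \<le> 1"
      by (simp add: power2_eq_square algebra_simps)
    then have "Q * (2 - Q) \<le> Q * s"
      using s(2) by linarith
    then have "2 - Q \<le> s"
      using \<open>0 < Q\<close> by simp
    then have "\<bar>1 - s\<bar> \<le> Q - 1"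
      using s(1) by linarith
    then show ?thesis
      using summ Q f(1) by (simp add: is_density_def s_def)
  qed
  then show ?thesis
    using k c by (intro exI[of _ "2 * k * c"] exI[of _ "2 * k * (1 + c)"]) simp
qed

end
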